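(* Let $\rho\in(0,1]$, let $\mu$ and $\sigma>0$ be such that $\Omega:=[\mu-\sqrt{3}\sigma,\mu+\sqrt{3}\sigma]\subset\mathbb{R}_+$, and let $\omega$ be uniformly distributed on $\Omega$ with law $\mathbf{P}$. Let $p^{\omega,*}=\frac1\rho\,\mathbf{1}_{\{\omega\in[\mu-\sqrt{3}\sigma,\mu]\}}$, $\pi_P^\omega=(\mu-\omega)^+/\rho$ and $\pi_W^\omega=\mu-(\mu-\omega)^+/\rho$. Let $\mathcal{A}_0=(0,1/\rho]\times(0,1/\rho]\times(0,\sqrt{3}\sigma]$ and $$\mathcal{A}_P=\{(q_P,K_P,\Delta_P)\in\mathcal{A}_0: K_P+2q_P\ge 1/\rho\},\qquad \mathcal{A}_W=\{(q_W,K_W,\Delta_W)\in\mathcal{A}_0: K_W+2q_W\le 1/\rho\}.$$ Consider the optimization problem $$\text{maximize}\quad \mathbb{E}\left[q_W\Delta_W-q_P\Delta_P-(p^{\omega,*}-K_W)^+\Delta_W+(p^{\omega,*}-K_P)^+\delta_P^\omega\right]$$ over triples $(q_P,K_P,\Delta_P)$, $(q_W,K_W,\Delta_W)$ in $\mathbb{R}_+^3$ and measurable maps $\omega\mapsto\delta_P^\omega$, subject to $\Delta_P=\Delta_W$, $(q_P,K_P,\Delta_P)\in\mathcal{A}_P$, $(q_W,K_W,\Delta_W)\in\mathcal{A}_W$, and, $\mathbf{P}$-almost surely, $\delta_P^\omega\in[0,\Delta_P]$ and $\delta_P^\omega=\Delta_W\mathbf{1}_{\{p^{\omega,*}\ge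 K_W\}}$. Then the triples $(q_i^*,K_i^*,\Delta_i^* )\in\mathbb{R}_+^3$ given by $$2q_i^*+K_i^*=\frac1\rho\quad\text{and}\quad \Delta_i^*\in(0,\sqrt{3}\sigma],\qquad\text{for each } i\in\{W,P\}$$ (with $\Delta_P^*=\Delta_W^*$, as the constraints require), constitute the optimal solution of this problem. Moreover, at $\Delta_i^*=\sqrt{3}\sigma$, the variances of the total payments satisfy, for each $i\in\{W,P\}$, $$\mathrm{var}\left[\Pi_i^\omega(q_i^*,K_i^*,\Delta_i^* )\right]-\mathrm{var}\left[\pi_i^\omega\right]=-\frac{3K_i^*\sigma^2}{2}<0.$$
   Context: Notation: $\mathbb{R}_+$ is the set of nonnegative reals; $z^+=\max\{z,0\}$; $\mathbf{1}$ denotes an indicator function; $\mathbb{E}$ and $\mathrm{var}$ denote expectation and variance under $\mathbf{P}$. Setting: a risk-neutral market maker clears a cash-settled call option market between one seller $P$ (a peaker power plant) and one buyer $W$ (a wind power producer), both risk-neutral; $q_i$ is the option price, $K_i$ the strike price and $\Delta_i$ the option volume for participant $i$, and $\delta_P^\omega$ is the volume of exercised options allocated to the seller in scenario $\omega$. The sets $\mathcal{A}_P$ and $\mathcal{A}_W$ are the trades acceptable to $P$ and $W$. The objective is the expected merchandising surplus of the market maker. The total payments (electricity market plus option trade) are $$\Pi_W^\omega(q,K,\Delta)=\pi_W^\omega-q\Delta+(p^{\omega,*}-K)^+\Delta,\qquad \Pi_P^\omega(q,K,\Delta)=\pi_P^\omega+q\Delta-(p^{\omega,*}-K)^+\Del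ta.$$
   Formalization: The printed variance difference −3K_i*σ²/2 is false (it lacks a factor q_i* ); the statement proved has −3q_i*K_i*σ²/2 < 0, and the optimal triples are taken with q_i* > 0 and K_i* > 0, as A_0 requires. *)

theory Defs
  imports "HOL-Probability.Probability"
begin

datatype participant = Peaker | Wind

definition scenarios :: "real \<Rightarrow> real \<Rightarrow> real set" where
  "scenarios \<mu> \<sigma> = {\<mu> - sqrt 3 * \<sigma> .. \<mu> + sqrt 3 * \<sigma>}"

text \<open>The law is carried by the whole real line: random variables are Borel maps on the reals, and
  their values outside the scenario set are irrelevant.\<close>

definition scenario_law :: "real \<Rightarrow> real \<Rightarrow> real measure" where
  "scenario_law \<mu> \<sigma> = uniform_measure lborel (scenarios \<mu> \<sigma>)"

definition spot_price :: "real \<Rightarrow> real \<Rightarrow> real \<Rightarrow> real \<Rightarrow> real" where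
  "spot_price \<rho> \<mu> \<sigma> \<omega> = 1 / \<rho> * indicator {\<mu> - sqrt 3 * \<sigma> .. \<mu>} \<omega>"

definition spot_payment :: "real \<Rightarrow> real \<Rightarrow> participant \<Rightarrow> real \<Rightarrow> real" where
  "spot_payment \<rho> \<mu> i \<omega> =
    (case i of
       Peaker \<Rightarrow> max (\<mu> - \<omega>) 0 / \<rho>
     | Wind \<Rightarrow> \<mu> - max (\<mu> - \<omega>) 0 / \<rho>)"

definition total_payment ::
    "real \<Rightarrow> real \<Rightarrow> real \<Rightarrow> participant \<Rightarrow> real \<times> real \<times> real \<Rightarrow> real \<Rightarrow> real" where
  "total_payment \<rho> \<mu> \<sigma> i = (\<lambda>(q, K, \<Delta>) \<omega>.
    (case i of
       Peaker \<Rightarrow> spot_payment \<rho> \<mu> Peaker \<omega> + q * \<Delta> - max (spot_price \<rho> \<mu> \<sigma> \<omega> - K) 0 * \<Delta>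
     | Wind \<Rightarrow> spot_payment \<rho> \<mu> Wind \<omega> - q * \<Delta> + max (spot_price \<rho> \<mu> \<sigma> \<omega> - K) 0 * \<Delta>))"

text \<open>A trade is a triple (option price, strike price, volume).\<close>

definition trade_box :: "real \<Rightarrow> real \<Rightarrow> (real \<times> real \<times> real) set" where
  "trade_box \<rho> \<sigma> = {0 <.. 1 / \<rho>} \<times> {0 <.. 1 / \<rho>} \<times> {0 <.. sqrt 3 * \<sigma>}"

definition acceptable :: "real \<Rightarrow> real \<Rightarrow> participant \<Rightarrow> (real \<times> real \<times> real) set" where
  "acceptable \<rho> \<sigma> i =
    (case i of
       Peaker \<Rightarrow> {(q, K, \<Delta>) \<in> trade_box \<rho> \<sigma>. K + 2 * q \<ge> 1 / \<rho>}
     | Wind \<Rightarrow> {(q, K, \<Delta>) \<in> trade_box \<rho> \<sigma>. K + 2 * q \<le> 1 / \<rho>})"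

text \<open>A decision of the market maker is (seller trade, buyer trade, allocation of exercised options).\<close>

type_synonym decision = "(real \<times> real \<times> real) \<times> (real \<times> real \<times> real) \<times> (real \<Rightarrow> real)"

definition exercised :: "real \<Rightarrow> real \<Rightarrow> real \<Rightarrow> real \<Rightarrow> real \<Rightarrow> real \<Rightarrow> real" where
  "exercised \<rho> \<mu> \<sigma> K \<Delta> \<omega> = \<Delta> * indicator {\<omega>. spot_price \<rho> \<mu> \<sigma> \<omega> \<ge> K} \<omega>"

definition expected_surplus :: "real \<Rightarrow> real \<Rightarrow> real \<Rightarrow> decision \<Rightarrow> real" where
  "expected_surplus \<rho> \<mu> \<sigma> = (\<lambda>((qP, KP, \<Delta>P), (qW, KW, \<Delta>W), \<delta>).
    prob_space.expectation (scenario_law \<mu> \<sigma>) (\<lambda>\<omega>.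
      qW * \<Delta>W - qP * \<Delta>P
      - max (spot_price \<rho> \<mu> \<sigma> \<omega> - KW) 0 * \<Delta>W
      + max (spot_price \<rho> \<mu> \<sigma> \<omega> - KP) 0 * \<delta> \<omega>))"

definition feasible :: "real \<Rightarrow> real \<Rightarrow> real \<Rightarrow> decision \<Rightarrow> bool" where
  "feasible \<rho> \<mu> \<sigma> = (\<lambda>((qP, KP, \<Delta>P), (qW, KW, \<Delta>W), \<delta>).
    (qP, KP, \<Delta>P) \<in> {0..} \<times> {0..} \<times> {0..} \<and> (qW, KW, \<Delta>W) \<in> {0..} \<times> {0..} \<times> {0..} \<and>
    \<delta> \<in> borel_measurable (scenario_law \<mu> \<sigma>) \<and>
    \<Delta>P = \<Delta>W \<and>
    (qP, KP, \<Delta>P) \<in> acceptable \<rho> \<sigma> Peaker \<and> (qW, KW, \<Delta>W) \<in> acceptable \<rho> \<sigma> Wind \<and>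
    (AE \<omega> in scenario_law \<mu> \<sigma>.
      \<delta> \<omega> \<in> {0..\<Delta>P} \<and> \<delta> \<omega> = exercised \<rho> \<mu> \<sigma> KW \<Delta>W \<omega>))"

definition optimal_decisions :: "real \<Rightarrow> real \<Rightarrow> real \<Rightarrow> decision set" where
  "optimal_decisions \<rho> \<mu> \<sigma> = {x. is_arg_max (expected_surplus \<rho> \<mu> \<sigma>) (feasible \<rho> \<mu> \<sigma>) x}"

end

theory Submission
  imports Defs
begin

text \<open>An exercised option pays exactly on the lower half of the scenario interval, an event of
  probability one half, so the expected surplus of a feasible decision with volume \<open>\<Delta>\<close> is
  \<open>\<Delta>/2 * ((2 * qW + KW) - (2 * qP + KP))\<close>. Acceptability makes it nonpositive, and zero exactly when
  both trades satisfy \<open>2 * q + K = 1 / \<rho>\<close>. On this line the option pays \<open>2 * q\<close> per unit on the lower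
  half, where the whole risk of the spot payments is concentrated, and the variances follow from
  the first moment of the shortfall below \<open>\<mu>\<close>.\<close>

section \<open>Integrals against uniform measures and variances of affine images\<close>

lemma integral_uniform_measure:
  fixes f :: "'a \<Rightarrow> real"
  assumes "A \<in> sets M" "emeasure M A \<noteq> 0" "emeasure M A \<noteq> \<infinity>" "f \<in> borel_measurable M"
  shows "integral\<^sup>L (uniform_measure M A) f = (\<integral>x. indicator A x * f x \<partial>M) / measure M A"
proof -
  have pos: "measure M A > 0"
    using assms(2,3) by (simp add: measure_def enn2real_positive_iff top.not_eq_extremum zero_less_iff_neq_zero)
  have em: "emeasure M A = ennreal (measure M A)"
    using assms(3) by (simp add: emeasure_eq_ennreal_measure)
  \<comment> \<open>As A has finite positive measure, the extended-real density is the image of a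
    real function, which is the form \<open>integral_density\<close> takes.\<close>
  have "uniform_measure M A = density M (\<lambda>x. ennreal (indicator A x / measure M A))"
    unfolding uniform_measure_def em using pos
    by (auto intro!: arg_cong[where f="density M"] simp: fun_eq_iff indicator_def divide_ennreal
        simp flip: ennreal_1)
  then have "integral\<^sup>L (uniform_measure M A) f = (\<integral>x. (indicator A x / measure M A) * f x \<partial>M)"
    using assms(1,4) by (simp add: integral_density)
  also have "\<dots> = (\<integral>x. indicator A x * f x \<partial>M) / measure M A"
    by simp
  finally show ?thesis .
qed

lemma (in prob_space) variance_affine:
  fixes X :: "'a \<Rightarrow> real"
  assumes "integrable M X"
  shows "variance (\<lambda>x. k + s * X x) = s\<^sup>2 * variance X"
proof -
  have "expectation (\<lambda>x. k + s * X x) = k + s * expectation X"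
    using assms by (simp add: prob_space)
  then have "(k + s * X x - expectation (\<lambda>x. k + s * X x))\<^sup>2 = s\<^sup>2 * (X x - expectation X)\<^sup>2" for x
    by (simp add: power2_eq_square algebra_simps)
  then show ?thesis by simp
qed

section \<open>Moments of the shortfall under the uniform law\<close>

locale uniform_scenarios =
  fixes \<mu> \<sigma> :: real
  assumes sigma_pos: "\<sigma> > 0"
begin

abbreviation half_width :: real where "half_width \<equiv> sqrt 3 * \<sigma>"

abbreviation law :: "real measure" where "law \<equiv> scenario_law \<mu> \<sigma>"

abbreviation low :: "real \<Rightarrow> real" where "low \<equiv> indicator {\<mu> - half_width .. \<mu>}"

abbreviation shortfall :: "real \<Rightarrow> real" where "shortfall \<equiv> \<lambda>\<omega>. max (\<mu> - \<omega>) 0"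

lemma half_width_pos: "half_width > 0"
  using sigma_pos by simp

lemma emeasure_scenarios: "emeasure lborel (scenarios \<mu> \<sigma>) = ennreal (2 * half_width)"
  using half_width_pos by (simp add: scenarios_def mult.commute)

lemma sets_law [measurable_cong]: "sets law = sets borel"
  by (simp add: scenario_law_def)

lemma AE_law_scenarios: "AE \<omega> in law. \<omega> \<in> scenarios \<mu> \<sigma>"
  unfolding scenario_law_def by (rule AE_uniform_measureI) (auto simp: scenarios_def)

sublocale prob_space law
  unfolding scenario_law_def using sigma_pos
  by (intro prob_space_uniform_measure) (simp_all add: emeasure_scenarios)

lemma expectation_eq:
  fixes f :: "real \<Rightarrow> real"
  assumes "f \<in> borel_measurable borel"
  shows "expectation f = (\<integral>x. indicator (scenarios \<mu> \<sigma>) x * f x \<partial>lborel) / (2 * half_width)"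
proof -
  have "measure lborel (scenarios \<mu> \<sigma>) = 2 * half_width"
    using half_width_pos by (simp add: measure_def emeasure_scenarios)
  moreover have "scenarios \<mu> \<sigma> \<in> sets lborel"
    by (simp add: scenarios_def)
  ultimately show ?thesis
    unfolding scenario_law_def using sigma_pos assms
    by (subst integral_uniform_measure) (simp_all add: emeasure_scenarios)
qed

lemma prob_low: "prob {\<mu> - half_width .. \<mu>} = 1 / 2"
proof -
  have "(\<integral>x. indicator (scenarios \<mu> \<sigma>) x * low x \<partial>lborel) = (\<integral>x. low x \<partial>lborel)"
    using half_width_pos
    by (intro Bochner_Integration.integral_cong) (auto simp: scenarios_def indicator_def)
  also have "\<dots> = half_width"
    using half_width_pos by simp
  finally show ?thesis
    using sigma_pos expectation_eq[of low] by simp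
qed

text \<open>The shortfall is zero on the upper half; on the lower half, of probability 1/2, it is
  uniform on [0, \<open>half_width\<close>].\<close>

lemma expectation_shortfall: "expectation shortfall = half_width / 4"
proof -
  have "(\<integral>x. indicator (scenarios \<mu> \<sigma>) x * shortfall x \<partial>lborel) = (\<integral>x. low x *\<^sub>R (\<mu> - x) \<partial>lborel)"
    using half_width_pos
    by (intro Bochner_Integration.integral_cong) (auto simp: scenarios_def indicator_def)
  also have "\<dots> = - (\<mu> - \<mu>)\<^sup>2 / 2 - (- (\<mu> - (\<mu> - half_width))\<^sup>2 / 2)"
    using half_width_pos
    by (intro integral_FTC_atLeastAtMost)
       (auto intro!: derivative_eq_intros continuous_intros simp: field_simps
         simp flip: has_real_derivative_iff_has_vector_derivative)
  finally show ?thesis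
    using half_width_pos by (simp add: expectation_eq power2_eq_square field_simps)
qed

lemma integrable_low: "integrable law low"
  by (rule integrable_const_bound[where B=1]) (auto simp: indicator_def)

text \<open>The law lives on the whole line, where the shortfall is unbounded, so the bound can only
  hold almost everywhere.\<close>

lemma AE_shortfall_le: "AE \<omega> in law. shortfall \<omega> \<le> half_width"
  using AE_law_scenarios by eventually_elim (use half_width_pos in \<open>auto simp: scenarios_def\<close>)

lemma integrable_shortfall: "integrable law shortfall"
  by (rule integrable_const_bound[where B=half_width]) (use AE_shortfall_le in auto)

lemma integrable_shortfall_sq: "integrable law (\<lambda>\<omega>. (shortfall \<omega>)\<^sup>2)"
proof (rule integrable_const_bound[where B="half_width\<^sup>2"])
  show "AE \<omega> in law. norm ((shortfall \<omega>)\<^sup>2) \<le> half_width\<^sup>2"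
    using AE_shortfall_le by eventually_elim (auto intro: power_mono)
qed measurable

text \<open>The variance of \<open>low\<close> is 1/4 and its covariance with the shortfall is
  \<open>half_width / 4 - half_width / 8\<close>. The second moment of the shortfall cancels and is
  never computed.\<close>

lemma variance_hedged_shortfall:
  "variance (\<lambda>\<omega>. shortfall \<omega> - c * low \<omega>) = variance shortfall - c * half_width / 4 + c\<^sup>2 / 4"
proof -
  let ?g = "\<lambda>\<omega>. (shortfall \<omega>)\<^sup>2 - 2 * c * shortfall \<omega> + c\<^sup>2 * low \<omega>"
  \<comment> \<open>On the scenarios \<open>shortfall * low = shortfall\<close>, which simplifies
    the cross term; to the left of the interval this fails.\<close>
  have sq: "AE \<omega> in law. (shortfall \<omega> - c * low \<omega>)\<^sup>2 = ?g \<omega>"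
    using AE_law_scenarios
    by eventually_elim (auto simp: scenarios_def indicator_def power2_eq_square algebra_simps)
  have g: "integrable law ?g"
    using integrable_low integrable_shortfall integrable_shortfall_sq by simp
  have "integrable law (\<lambda>\<omega>. (shortfall \<omega> - c * low \<omega>)\<^sup>2)"
    by (subst integrable_cong_AE[OF _ _ sq]) (use g in auto)
  then have "variance (\<lambda>\<omega>. shortfall \<omega> - c * low \<omega>)
      = expectation (\<lambda>\<omega>. (shortfall \<omega> - c * low \<omega>)\<^sup>2) - (expectation (\<lambda>\<omega>. shortfall \<omega> - c * low \<omega>))\<^sup>2"
    using integrable_low integrable_shortfall by (intro variance_eq) simp_all
  moreover have "expectation (\<lambda>\<omega>. (shortfall \<omega> - c * low \<omega>)\<^sup>2) = expectation ?g"
    by (rule integral_cong_AE) (use sq in auto)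
  moreover have "expectation ?g = expectation (\<lambda>\<omega>. (shortfall \<omega>)\<^sup>2) - c * half_width / 2 + c\<^sup>2 / 2"
    using integrable_low integrable_shortfall integrable_shortfall_sq
    by (simp add: prob_low expectation_shortfall)
  moreover have mean: "expectation (\<lambda>\<omega>. shortfall \<omega> - c * low \<omega>) = half_width / 4 - c / 2"
    using integrable_low integrable_shortfall by (simp add: prob_low expectation_shortfall)
  moreover have "variance shortfall = expectation (\<lambda>\<omega>. (shortfall \<omega>)\<^sup>2) - (half_width / 4)\<^sup>2"
    using variance_eq[OF integrable_shortfall integrable_shortfall_sq]
    by (simp only: expectation_shortfall)
  moreover have "(half_width / 4 - c / 2)\<^sup>2 = (half_width / 4)\<^sup>2 - c * half_width / 4 + c\<^sup>2 / 4"
    by (simp add: power2_diff power_divide)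
  ultimately show ?thesis
    unfolding mean by linarith
qed

section \<open>Option payoffs and the variance of total payments\<close>

lemma measurable_exercised [measurable]: "exercised \<rho> \<mu> \<sigma> K \<Delta> \<in> borel_measurable borel"
  unfolding exercised_def spot_price_def by measurable

lemma option_payoff_eq:
  assumes "0 < K" "K \<le> 1 / \<rho>"
  shows "max (spot_price \<rho> \<mu> \<sigma> \<omega> - K) 0 = (1 / \<rho> - K) * low \<omega>"
  using assms by (auto simp: spot_price_def indicator_def)

text \<open>A strictly positive strike rules out exercise at price zero, and K \<le> 1/\<rho> forces
  it at the high price, also for K = 1/\<rho>, where it pays nothing.\<close>

lemma exercised_eq:
  assumes "0 < K" "K \<le> 1 / \<rho>"
  shows "exercised \<rho> \<mu> \<sigma> K \<Delta> \<omega> = \<Delta> * low \<omega>"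
  using assms by (auto simp: exercised_def spot_price_def indicator_def)

text \<open>Up to constants, the two participants hold opposite multiples of one hedged shortfall,
  so a single computation serves both.\<close>

lemma variance_total_payment:
  assumes "0 < \<rho>" "0 < q" "0 < K" "2 * q + K = 1 / \<rho>"
  shows "variance (total_payment \<rho> \<mu> \<sigma> i (q, K, half_width)) - variance (spot_payment \<rho> \<mu> i)
    = - (3 * q * K * \<sigma>\<^sup>2 / 2)"
proof -
  \<comment> \<open>The option pays \<open>2 * q * half_width\<close> on the lower half; c is this
    amount once the factor 1/\<rho> of the spot payment is pulled out.\<close>
  define c where "c = 2 * \<rho> * q * half_width"
  have pay: "max (spot_price \<rho> \<mu> \<sigma> \<omega> - K) 0 = 2 * q * low \<omega>" for \<omega>
    using assms option_payoff_eq[of K \<rho>] by (simp add: algebra_simps flip: assms(4))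
  \<comment> \<open>s is 1/\<rho> for the seller and -1/\<rho> for the buyer; the variance sees only
    its square.\<close>
  obtain k l s where s: "s\<^sup>2 = (1 / \<rho>)\<^sup>2"
    and total: "total_payment \<rho> \<mu> \<sigma> i (q, K, half_width) = (\<lambda>\<omega>. k + s * (shortfall \<omega> - c * low \<omega>))"
    and spot: "spot_payment \<rho> \<mu> i = (\<lambda>\<omega>. l + s * shortfall \<omega>)"
  proof (cases i)
    case Peaker
    show ?thesis
      by (rule that[of "1 / \<rho>" "q * half_width" 0])
         (use assms(1) in \<open>auto simp: Peaker total_payment_def spot_payment_def pay c_def field_simps\<close>)
  next
    case Wind
    show ?thesis
      by (rule that[of "- 1 / \<rho>" "\<mu> - q * half_width" \<mu>])
         (use assms(1) in \<open>auto simp: Wind total_payment_def spot_payment_def pay c_def field_simps\<close>)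
  qed
  have "variance (total_payment \<rho> \<mu> \<sigma> i (q, K, half_width)) - variance (spot_payment \<rho> \<mu> i)
      = (1 / \<rho>)\<^sup>2 * (c\<^sup>2 / 4 - c * half_width / 4)"
    unfolding total spot using integrable_low integrable_shortfall
    by (subst (1 2) variance_affine)
       (simp_all only: variance_hedged_shortfall s Bochner_Integration.integrable_diff
         integrable_mult_right, simp add: algebra_simps)
  also have "\<dots> = q * half_width\<^sup>2 * (q - 1 / \<rho> / 2)"
    using assms(1) by (simp add: c_def power2_eq_square field_simps)
  \<comment> \<open>On the line, q - 1/(2\<rho>) = -K/2, and the squared half width is three times
    the square of \<sigma>.\<close>
  also have "\<dots> = - (3 * q * K * \<sigma>\<^sup>2 / 2)"
    by (simp add: power_mult_distrib algebra_simps flip: assms(4))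
  finally show ?thesis .
qed

section \<open>Feasible decisions, their surplus and the maximizers\<close>

lemma feasible_iff:
  "feasible \<rho> \<mu> \<sigma> ((qP, KP, \<Delta>P), (qW, KW, \<Delta>W), \<delta>) \<longleftrightarrow>
    (qP, KP, \<Delta>P) \<in> trade_box \<rho> \<sigma> \<and> KP + 2 * qP \<ge> 1 / \<rho> \<and>
    (qW, KW, \<Delta>W) \<in> trade_box \<rho> \<sigma> \<and> KW + 2 * qW \<le> 1 / \<rho> \<and> \<Delta>P = \<Delta>W \<and>
    \<delta> \<in> borel_measurable law \<and> (AE \<omega> in law. \<delta> \<omega> = exercised \<rho> \<mu> \<sigma> KW \<Delta>W \<omega>)"
    (is "?L \<longleftrightarrow> ?R")
proof
  assume ?L
  then have "AE \<omega> in law. \<delta> \<omega> = exercised \<rho> \<mu> \<sigma> KW \<Delta>W \<omega>"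
    unfolding feasible_def by (auto elim: eventually_mono)
  with \<open>?L\<close> show ?R
    by (auto simp: feasible_def acceptable_def)
next
  assume R: ?R
  then have "0 \<le> \<Delta>W" "AE \<omega> in law. \<delta> \<omega> = exercised \<rho> \<mu> \<sigma> KW \<Delta>W \<omega>"
    by (auto simp: trade_box_def)
  \<comment> \<open>\<open>exercised\<close> takes only the values 0 and \<Delta>W, which puts
    \<delta> in the required range.\<close>
  then have "AE \<omega> in law. \<delta> \<omega> \<in> {0..\<Delta>W} \<and> \<delta> \<omega> = exercised \<rho> \<mu> \<sigma> KW \<Delta>W \<omega>"
    by (auto simp: exercised_def indicator_def elim!: eventually_mono)
  with R show ?L
    by (auto simp: feasible_def acceptable_def trade_box_def)
qed

lemma expected_surplus_eq:
  assumes "feasible \<rho> \<mu> \<sigma> ((qP, KP, \<Delta>P), (qW, KW, \<Delta>W), \<delta>)"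
  shows "expected_surplus \<rho> \<mu> \<sigma> ((qP, KP, \<Delta>P), (qW, KW, \<Delta>W), \<delta>)
    = \<Delta>W / 2 * ((2 * qW + KW) - (2 * qP + KP))"
proof -
  have box: "0 < KP" "KP \<le> 1 / \<rho>" "0 < KW" "KW \<le> 1 / \<rho>" and vol: "\<Delta>P = \<Delta>W"
    and [measurable]: "\<delta> \<in> borel_measurable law"
    and ex: "AE \<omega> in law. \<delta> \<omega> = exercised \<rho> \<mu> \<sigma> KW \<Delta>W \<omega>"
    using assms by (auto simp: feasible_iff trade_box_def)
  have "expected_surplus \<rho> \<mu> \<sigma> ((qP, KP, \<Delta>P), (qW, KW, \<Delta>W), \<delta>) =
      expectation (\<lambda>\<omega>. qW * \<Delta>W - qP * \<Delta>W - (1 / \<rho> - KW) * low \<omega> * \<Delta>W + (1 / \<rho> - KP) * low \<omega> * \<delta> \<omega>)"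
    by (simp add: expected_surplus_def vol option_payoff_eq box)
  \<comment> \<open>On the lower half \<delta> equals \<Delta>W almost surely and 1/\<rho> cancels
    between the two payoffs; above \<mu> both payoffs vanish.\<close>
  also have "\<dots> = expectation (\<lambda>\<omega>. (qW - qP) * \<Delta>W + (KW - KP) * \<Delta>W * low \<omega>)"
  proof (rule integral_cong_AE)
    show "AE \<omega> in law. qW * \<Delta>W - qP * \<Delta>W - (1 / \<rho> - KW) * low \<omega> * \<Delta>W + (1 / \<rho> - KP) * low \<omega> * \<delta> \<omega>
        = (qW - qP) * \<Delta>W + (KW - KP) * \<Delta>W * low \<omega>"
      using ex
      by eventually_elim (use box in \<open>auto simp: exercised_eq indicator_def algebra_simps\<close>)
  qed measurable
  also have "\<dots> = \<Delta>W / 2 * ((2 * qW + KW) - (2 * qP + KP))"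
    using integrable_low by (simp add: prob_space prob_low) (simp add: field_simps)
  finally show ?thesis .
qed

lemma expected_surplus_nonpos:
  assumes "feasible \<rho> \<mu> \<sigma> x"
  shows "expected_surplus \<rho> \<mu> \<sigma> x \<le> 0"
proof -
  obtain qP KP \<Delta>P qW KW \<Delta>W \<delta> where x: "x = ((qP, KP, \<Delta>P), (qW, KW, \<Delta>W), \<delta>)"
    by (metis prod.exhaust)
  have "0 < \<Delta>W" "(2 * qW + KW) - (2 * qP + KP) \<le> 0"
    using assms by (auto simp: x feasible_iff trade_box_def)
  then show ?thesis
    unfolding x expected_surplus_eq[OF assms[unfolded x]] by (intro mult_nonneg_nonpos) simp_all
qed

text \<open>Since \<Delta>W > 0, zero surplus forces 2qW + KW = 2qP + KP; acceptability places
  1/\<rho> between these two numbers.\<close>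

lemma expected_surplus_eq_0_iff:
  assumes "feasible \<rho> \<mu> \<sigma> ((qP, KP, \<Delta>P), (qW, KW, \<Delta>W), \<delta>)"
  shows "expected_surplus \<rho> \<mu> \<sigma> ((qP, KP, \<Delta>P), (qW, KW, \<Delta>W), \<delta>) = 0 \<longleftrightarrow>
    2 * qP + KP = 1 / \<rho> \<and> 2 * qW + KW = 1 / \<rho>"
  using assms unfolding expected_surplus_eq[OF assms] by (auto simp: feasible_iff trade_box_def)

text \<open>Shows that the upper bound 0 is attained. Both sides get the same trade, the point of
  the line with K = 2q.\<close>

lemma ex_feasible_surplus_0:
  assumes "\<rho> > 0"
  shows "\<exists>x. feasible \<rho> \<mu> \<sigma> x \<and> expected_surplus \<rho> \<mu> \<sigma> x = 0"
proof -
  let ?t = "(1 / (4 * \<rho>), 1 / (2 * \<rho>), half_width)"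
  have *: "feasible \<rho> \<mu> \<sigma> (?t, ?t, exercised \<rho> \<mu> \<sigma> (1 / (2 * \<rho>)) half_width)"
    using assms half_width_pos by (simp add: feasible_iff trade_box_def field_simps)
  with assms show ?thesis
    by (intro exI[of _ "(?t, ?t, exercised \<rho> \<mu> \<sigma> (1 / (2 * \<rho>)) half_width)"])
       (simp add: expected_surplus_eq)
qed

lemma optimal_iff:
  assumes "\<rho> > 0"
  shows "x \<in> optimal_decisions \<rho> \<mu> \<sigma> \<longleftrightarrow> feasible \<rho> \<mu> \<sigma> x \<and> expected_surplus \<rho> \<mu> \<sigma> x = 0"
  using ex_feasible_surplus_0[OF assms] expected_surplus_nonpos
  unfolding optimal_decisions_def is_arg_max_def mem_Collect_eq
  by (metis linorder_neqE_linordered_idom not_less)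

lemma optimal_decision_iff:
  assumes "\<rho> > 0"
  shows "((qP, KP, \<Delta>P), (qW, KW, \<Delta>W), \<delta>) \<in> optimal_decisions \<rho> \<mu> \<sigma> \<longleftrightarrow>
    0 < qP \<and> 0 < KP \<and> 2 * qP + KP = 1 / \<rho> \<and> \<Delta>P \<in> {0 <.. half_width} \<and>
    0 < qW \<and> 0 < KW \<and> 2 * qW + KW = 1 / \<rho> \<and> \<Delta>W \<in> {0 <.. half_width} \<and>
    \<Delta>P = \<Delta>W \<and> \<delta> \<in> borel_measurable law \<and>
    (AE \<omega> in law. \<delta> \<omega> = exercised \<rho> \<mu> \<sigma> KW \<Delta>W \<omega>)" (is "?L \<longleftrightarrow> ?R")
proof
  assume ?L
  then show ?R
    using expected_surplus_eq_0_iff[of \<rho> qP KP \<Delta>P qW KW \<Delta>W \<delta>]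
    by (auto simp: optimal_iff[OF assms] feasible_iff trade_box_def)
next
  assume R: ?R
  \<comment> \<open>The bounds q, K \<le> 1/\<rho> of the box follow from positivity and the
    line.\<close>
  then have "feasible \<rho> \<mu> \<sigma> ((qP, KP, \<Delta>P), (qW, KW, \<Delta>W), \<delta>)"
    by (simp add: feasible_iff trade_box_def)
  with R show ?L
    by (simp add: optimal_iff[OF assms] expected_surplus_eq_0_iff)
qed

end

text \<open>Prices and strikes are strictly positive because the box excludes zero, and the
  allocation is determined up to a null set. The variance reduction carries a factor q; it agrees
  with the informal formula, which lacks this factor, only for q = 1.\<close>

theorem proposition2:
  fixes \<rho> \<mu> \<sigma> :: real
  assumes "\<rho> \<in> {0<..1}" and "\<sigma> > 0" and "scenarios \<mu> \<sigma> \<subseteq> {0..}"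
  shows
    "optimal_decisions \<rho> \<mu> \<sigma> =
       {((qP, KP, \<Delta>P), (qW, KW, \<Delta>W), \<delta>) | qP KP \<Delta>P qW KW \<Delta>W \<delta>.
          0 < qP \<and> 0 < KP \<and> 2 * qP + KP = 1 / \<rho> \<and> \<Delta>P \<in> {0 <.. sqrt 3 * \<sigma>} \<and>
          0 < qW \<and> 0 < KW \<and> 2 * qW + KW = 1 / \<rho> \<and> \<Delta>W \<in> {0 <.. sqrt 3 * \<sigma>} \<and>
          \<Delta>P = \<Delta>W \<and>
          \<delta> \<in> borel_measurable (scenario_law \<mu> \<sigma>) \<and>
          (AE \<omega> in scenario_law \<mu> \<sigma>. \<delta> \<omega> = exercised \<rho> \<mu> \<sigma> KW \<Delta>W \<omega>)} \<and>
     (\<forall>i q K. 0 < q \<and> 0 < K \<and> 2 * q + K = 1 / \<rho> \<longrightarrow>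
        prob_space.variance (scenario_law \<mu> \<sigma>) (total_payment \<rho> \<mu> \<sigma> i (q, K, sqrt 3 * \<sigma>))
          - prob_space.variance (scenario_law \<mu> \<sigma>) (spot_payment \<rho> \<mu> i)
          = - (3 * q * K * \<sigma>\<^sup>2 / 2) \<and>
        - (3 * q * K * \<sigma>\<^sup>2 / 2) < 0)"
proof -
  interpret uniform_scenarios \<mu> \<sigma>
    using assms(2) by unfold_locales
  have rho: "\<rho> > 0"
    using assms(1) by simp
  show ?thesis (is "_ = ?S \<and> ?V")
  proof
    show "optimal_decisions \<rho> \<mu> \<sigma> = ?S"
    proof (rule set_eqI)
      fix x :: decision
      obtain qP KP \<Delta>P qW KW \<Delta>W \<delta> where x: "x = ((qP, KP, \<Delta>P), (qW, KW, \<Delta>W), \<delta>)"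
        by (metis prod.exhaust)
      show "x \<in> optimal_decisions \<rho> \<mu> \<sigma> \<longleftrightarrow> x \<in> ?S"
        unfolding x optimal_decision_iff[OF rho] by auto
    qed
    show ?V
      using variance_total_payment[OF rho] sigma_pos by simp
  qed
qed

end
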